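(* Let $\mathbb{R}^+=[0,\infty)$. Let $f\in C^2(\mathbb{R})$ with $f(0)\ge 0$, and suppose the equation $dy/dt=f(y)$ has finitely many equilibria, each hyperbolic ($f'(y^* )\neq 0$ at every equilibrium $y^*$). Let $$f(y)=f^+(y)+y f^-(y)\quad (y\in\mathbb{R}^+),\qquad f^+,f^-\in C^1(\mathbb{R}^+),\quad f^+\ge 0,\ f^-\le 0 \text{ on } \mathbb{R}^+,$$ be a given representation of $f$. Let $\alpha,\beta$ be real numbers and $\varphi:\mathbb{R}^+\times\mathbb{R}^+\to\mathbb{R}^+$, $(h,y)\mapsto\varphi(h,y)$, a function. Consider the finite difference scheme with step size $h>0$ $$\frac{y_{n+1}-y_n}{\varphi(h,y_n)}=f^+(y_n)+\alpha\, y_n f^-(y_n)+\beta\, y_{n+1}f^-(y_n).$$ Let $\Omega^s$ be the set of equilibria $y^*$ of $dy/dt=f(y)$ with $f'(y^* )<0$. The scheme is positive, elementary stable and accurate of order $2$ if (H1) $\varphi(h,y)=h+\mathcal{O}(h^2)$ as $h\to 0$, and $\varphi(h,y)\ge 0$ for all $(h,y)\in\mathbb{R}^+\times\mathbb{R}^+$; (H2) $\varphi(h,y^* )<\dfrac{2}{2\beta f^-(y^* )-f'(y^* )}$ for all $y^*\in\Omega^s$ (for every step size $h>0$); (H3) $\dfrac{\partial^2\varphi}{\partial h^2}(0,y)=f'(y)-2\beta f^-(y)$ for all $y\ge 0$; (H4) $\alpha+\beta=1$, $\alpha\le 0$, $\beta\ge 0$.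
   Context: Equilibria are considered in $\mathbb{R}^+$, where $f^\pm$ and $\varphi(h,\cdot)$ are defined. Using $\alpha+\beta=1$, the scheme is rewritten in the explicit form $y_{n+1}=G(h,y_n)$ with $$G(h,y)=y+\frac{\varphi(h,y)f(y)}{1-\varphi(h,y)\beta f^-(y)}.$$ Positive: for every step size $h>0$ and every $y_0\ge 0$, one has $y_n\ge 0$ for all $n\in\mathbb{N}$. Elementary stable: for every step size $h>0$, the only fixed points $y^*$ of the scheme are the same as the equilibria of $dy/dt=f(y)$, and the local stability properties of each $y^*$ are the same for both the differential equation and the scheme. Accurate of order $2$: for the solution $y(\cdot)$ of $dy/dt=f(y)$, with $t_n=nh$, one has $y(t_{n+1})-G(h,y(t_n))=\mathcal{O}(h^3)$. $C^1(\mathbb{R}^+)$ denotes continuously differentiable functions on $[0,\infty)$.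
   Formalization: Added on φ: φ(h,y)≠0 for h>0; φ(h,·) continuous on R⁺ for each h>0; φ three times differentiable in h near h=0, locally uniformly in y, with jointly continuous third derivative. Otherwise false: f=1, φ=h+h^{5/2} has error h^{5/2}; φ huge near y* destroys stability. *)

theory Defs
  imports "HOL-Analysis.Analysis" "HOL-Library.Landau_Symbols"
begin

text \<open>
  The half-line \<open>[0,\<infinity>)\<close> is \<open>{0..}\<close>. Functions whose domain is the half-line are total functions
  on the reals that are only ever constrained on \<open>{0..}\<close>; derivatives at the end point are
  one-sided.
\<close>

definition C1_on :: "real set \<Rightarrow> (real \<Rightarrow> real) \<Rightarrow> bool" where
  "C1_on S g \<longleftrightarrow>
    (\<exists>g'. (\<forall>x\<in>S. (g has_real_derivative g' x) (at x within S)) \<and> continuous_on S g')"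

definition C2_on :: "real set \<Rightarrow> (real \<Rightarrow> real) \<Rightarrow> bool" where
  "C2_on S g \<longleftrightarrow>
    (\<exists>g'. (\<forall>x\<in>S. (g has_real_derivative g' x) (at x within S)) \<and> C1_on S g')"

definition equilibria :: "(real \<Rightarrow> real) \<Rightarrow> real set" where
  "equilibria f = {p. 0 \<le> p \<and> f p = 0}"

definition stable_equilibria :: "(real \<Rightarrow> real) \<Rightarrow> real set" where
  "stable_equilibria f = {p \<in> equilibria f. deriv f p < 0}"

definition solves_ode :: "(real \<Rightarrow> real) \<Rightarrow> (real \<Rightarrow> real) \<Rightarrow> real set \<Rightarrow> bool" where
  "solves_ode f y I \<longleftrightarrow> (\<forall>t\<in>I. (y has_real_derivative f (y t)) (at t within I))"


subsection \<open>The denominator function\<close>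

text \<open>Partial derivative in the first argument (the step size), one-sided at \<open>h = 0\<close>.\<close>

definition partial_h :: "(real \<Rightarrow> real \<Rightarrow> real) \<Rightarrow> real \<Rightarrow> real \<Rightarrow> real" where
  "partial_h \<phi> h y = vector_derivative (\<lambda>s. \<phi> s y) (at h within {0..})"

text \<open>
  \<open>\<phi>\<close> is three times differentiable in \<open>h\<close> near \<open>h = 0\<close>, with jointly continuous third derivative.
  The range of step sizes may shrink as \<open>y\<close> grows. The existence of a second derivative at
  \<open>h = 0\<close> alone would only give a remainder \<open>o(h\<^sup>2)\<close> in the Taylor expansion of \<open>\<phi>\<close>,
  as \<open>\<phi>(h,y) = h + a h\<^sup>2 + h\<^sup>2 \<surd>h\<close> shows.
\<close>

definition C3_in_h_near_0 :: "(real \<Rightarrow> real \<Rightarrow> real) \<Rightarrow> bool" where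
  "C3_in_h_near_0 \<phi> \<longleftrightarrow>
    (\<forall>M\<ge>0. \<exists>\<delta>>0.
      (\<forall>k<3. \<forall>h\<in>{0..<\<delta>}. \<forall>y\<in>{0..M}.
         (\<lambda>s. (partial_h ^^ k) \<phi> s y) differentiable (at h within {0..})) \<and>
      continuous_on ({0..<\<delta>} \<times> {0..M}) (\<lambda>(h, y). (partial_h ^^ 3) \<phi> h y))"


subsection \<open>The scheme\<close>

text \<open>\<open>fp\<close> and \<open>fm\<close> stand for \<open>f\<^sup>+\<close> and \<open>f\<^sup>-\<close>; \<open>y'\<close> is the successor of \<open>y\<close>.\<close>

definition scheme ::
  "(real \<Rightarrow> real) \<Rightarrow> (real \<Rightarrow> real) \<Rightarrow> (real \<Rightarrow> real \<Rightarrow> real) \<Rightarrow> real \<Rightarrow> real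
    \<Rightarrow> real \<Rightarrow> real \<Rightarrow> real \<Rightarrow> bool" where
  "scheme fp fm \<phi> \<alpha> \<beta> h y y' \<longleftrightarrow>
    (y' - y) / \<phi> h y = fp y + \<alpha> * y * fm y + \<beta> * y' * fm y"

definition scheme_map ::
  "(real \<Rightarrow> real) \<Rightarrow> (real \<Rightarrow> real) \<Rightarrow> (real \<Rightarrow> real \<Rightarrow> real) \<Rightarrow> real
    \<Rightarrow> real \<Rightarrow> real \<Rightarrow> real" where
  "scheme_map f fm \<phi> \<beta> h y = y + \<phi> h y * f y / (1 - \<phi> h y * \<beta> * fm y)"

text \<open>
  The implicit equation determines the successor uniquely, so orbits of the scheme exist for
  every starting value and are the iterates of \<open>scheme_map\<close>.
\<close>

lemma scheme_iff_scheme_map: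
  assumes "\<phi> h y > 0" "\<alpha> + \<beta> = 1" "\<beta> \<ge> 0" "fm y \<le> 0" "f y = fp y + y * fm y"
  shows "scheme fp fm \<phi> \<alpha> \<beta> h y y' \<longleftrightarrow> y' = scheme_map f fm \<phi> \<beta> h y"
proof -
  define p where "p = \<phi> h y"
  have p: "p > 0" using assms(1) by (simp add: p_def)
  have "p * \<beta> * fm y \<le> 0"
    using p assms(3,4) by (simp add: mult_nonneg_nonpos)
  hence D: "1 - p * \<beta> * fm y > 0" by linarith
  have a: "\<alpha> = 1 - \<beta>" using assms(2) by simp
  have "scheme fp fm \<phi> \<alpha> \<beta> h y y' \<longleftrightarrow>
      y' - y = p * (fp y + \<alpha> * y * fm y + \<beta> * y' * fm y)"
    using p by (simp add: scheme_def p_def[symmetric] divide_eq_eq mult.commute)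
  also have "\<dots> \<longleftrightarrow> (y' - y) * (1 - p * \<beta> * fm y) = p * f y"
    unfolding a assms(5) by (simp add: algebra_simps)
  also have "\<dots> \<longleftrightarrow> y' - y = p * f y / (1 - p * \<beta> * fm y)"
    using D by (simp add: eq_divide_eq)
  also have "\<dots> \<longleftrightarrow> y' = scheme_map f fm \<phi> \<beta> h y"
    by (auto simp: scheme_map_def p_def)
  finally show ?thesis .
qed


subsection \<open>Local stability\<close>

text \<open>
  Stability is relative to the state space \<open>[0,\<infinity>)\<close>. For the differential equation, stability
  refers to solutions on all compact time intervals, so that a solution that cannot be continued
  to \<open>[0,\<infinity>)\<close> is not overlooked; attractivity is only used together with stability, where
  solutions starting close to \<open>p\<close> are global.
\<close>

definition ode_stable :: "(real \<Rightarrow> real) \<Rightarrow> real \<Rightarrow> bool" where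
  "ode_stable f p \<longleftrightarrow>
    (\<forall>\<epsilon>>0. \<exists>\<delta>>0. \<forall>T\<ge>0. \<forall>y. solves_ode f y {0..T} \<and> 0 \<le> y 0 \<and> \<bar>y 0 - p\<bar> < \<delta> \<longrightarrow>
       (\<forall>t\<in>{0..T}. \<bar>y t - p\<bar> < \<epsilon>))"

definition ode_asymptotically_stable :: "(real \<Rightarrow> real) \<Rightarrow> real \<Rightarrow> bool" where
  "ode_asymptotically_stable f p \<longleftrightarrow> ode_stable f p \<and>
    (\<exists>\<delta>>0. \<forall>y. solves_ode f y {0..} \<and> 0 \<le> y 0 \<and> \<bar>y 0 - p\<bar> < \<delta> \<longrightarrow> (y \<longlongrightarrow> p) at_top)"

definition orbit :: "(real \<Rightarrow> real \<Rightarrow> bool) \<Rightarrow> (nat \<Rightarrow> real) \<Rightarrow> bool" where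
  "orbit R y \<longleftrightarrow> 0 \<le> y 0 \<and> (\<forall>n. R (y n) (y (Suc n)))"

definition step_stable :: "(real \<Rightarrow> real \<Rightarrow> bool) \<Rightarrow> real \<Rightarrow> bool" where
  "step_stable R p \<longleftrightarrow>
    (\<forall>\<epsilon>>0. \<exists>\<delta>>0. \<forall>y. orbit R y \<and> \<bar>y 0 - p\<bar> < \<delta> \<longrightarrow> (\<forall>n. \<bar>y n - p\<bar> < \<epsilon>))"

definition step_asymptotically_stable :: "(real \<Rightarrow> real \<Rightarrow> bool) \<Rightarrow> real \<Rightarrow> bool" where
  "step_asymptotically_stable R p \<longleftrightarrow> step_stable R p \<and>
    (\<exists>\<delta>>0. \<forall>y. orbit R y \<and> \<bar>y 0 - p\<bar> < \<delta> \<longrightarrow> y \<longlonglongrightarrow> p)"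


subsection \<open>Properties of a scheme\<close>

text \<open>
  Below, \<open>S h y y'\<close> means that the scheme with step size \<open>h\<close> admits the step from \<open>y\<close> to \<open>y'\<close>.
\<close>

definition positive_scheme :: "(real \<Rightarrow> real \<Rightarrow> real \<Rightarrow> bool) \<Rightarrow> bool" where
  "positive_scheme S \<longleftrightarrow> (\<forall>h>0. \<forall>y. orbit (S h) y \<longrightarrow> (\<forall>n. 0 \<le> y n))"

definition fixed_points :: "(real \<Rightarrow> real \<Rightarrow> bool) \<Rightarrow> real set" where
  "fixed_points R = {p. 0 \<le> p \<and> R p p}"

definition elementary_stable :: "(real \<Rightarrow> real) \<Rightarrow> (real \<Rightarrow> real \<Rightarrow> real \<Rightarrow> bool) \<Rightarrow> bool" where
  "elementary_stable f S \<longleftrightarrow>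
    (\<forall>h>0. fixed_points (S h) = equilibria f \<and>
      (\<forall>p\<in>equilibria f.
         (ode_stable f p \<longleftrightarrow> step_stable (S h) p) \<and>
         (ode_asymptotically_stable f p \<longleftrightarrow> step_asymptotically_stable (S h) p)))"

text \<open>
  The local truncation error is \<open>O(h\<^sup>k\<^sup>+\<^sup>1)\<close> as \<open>h \<rightarrow> 0\<close> along every solution starting in \<open>[0,\<infinity>)\<close>,
  uniformly over the grid points of a compact time interval.
\<close>

definition accurate_of_order :: "nat \<Rightarrow> (real \<Rightarrow> real) \<Rightarrow> (real \<Rightarrow> real \<Rightarrow> real) \<Rightarrow> bool" where
  "accurate_of_order k f G \<longleftrightarrow>
    (\<forall>T>0. \<forall>y. solves_ode f y {0..T} \<and> 0 \<le> y 0 \<longrightarrow>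
      (\<exists>C. \<exists>h\<^sub>0>0. \<forall>h\<in>{0<..<h\<^sub>0}. \<forall>n. real (Suc n) * h \<le> T \<longrightarrow>
         \<bar>y (real (Suc n) * h) - G h (y (real n * h))\<bar> \<le> C * h ^ (k + 1)))"

end

theory Submission
  imports Defs
begin

text \<open>
  At an equilibrium \<open>p\<close> the scheme map \<open>G\<close> has derivative \<open>1 + k f'(p)\<close> with
  \<open>k = \<phi> / (1 - \<phi> \<beta> f\<^sup>-) > 0\<close>, where differentiability needs only continuity of \<open>\<phi>(h,\<cdot>)\<close> because
  \<open>f(p) = 0\<close>. So \<open>f'(p) > 0\<close> makes \<open>p\<close> repelling, and for \<open>f'(p) < 0\<close> condition (H2) says exactly
  that the derivative exceeds \<open>-1\<close>. Positivity holds because the numerator of \<open>G\<close> is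
  \<open>y + \<phi> f\<^sup>+ + \<phi> \<alpha> y f\<^sup>- \<ge> 0\<close>. Condition (H3) is what turns the Taylor expansion of \<open>\<phi>\<close> into
  \<open>\<phi> / (1 - \<phi> \<beta> f\<^sup>-) = h + f' h\<^sup>2 / 2 + O(h\<^sup>3)\<close>, matching \<open>y'' = f'(y) f(y)\<close>.
\<close>

subsection \<open>Scalar autonomous differential equations\<close>

lemma solves_ode_subset:
  "solves_ode f y I \<Longrightarrow> J \<subseteq> I \<Longrightarrow> solves_ode f y J"
  unfolding solves_ode_def using has_field_derivative_subset by blast

lemma solves_ode_continuous_on: "solves_ode f y I \<Longrightarrow> continuous_on I y"
  unfolding solves_ode_def by (rule DERIV_continuous_on) blast

lemma solves_ode_interior:
  assumes "solves_ode f y {a..b}" "a < t" "t < b"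
  shows "(y has_real_derivative f (y t)) (at t)"
  using assms unfolding solves_ode_def by (metis at_within_Icc_at atLeastAtMost_iff less_imp_le)

text \<open>The dissipativity bound makes the weighted square \<open>?W\<close> nonincreasing along
  the solution; squaring removes the kink of the absolute value at \<open>p\<close>. Closeness to
  \<open>p\<close> is required only strictly between \<open>0\<close> and \<open>t\<close>, so that
  \<open>t\<close> may be a first exit time from the ball.\<close>

lemma ode_contraction_on_Icc:
  assumes y: "solves_ode f y {0..t}" and "0 \<le> t" "0 \<le> c"
    and f: "\<And>x. \<bar>x - p\<bar> \<le> r \<Longrightarrow> (x - p) * f x \<le> - c * (x - p)\<^sup>2"
    and near: "\<And>s. 0 < s \<Longrightarrow> s < t \<Longrightarrow> \<bar>y s - p\<bar> \<le> r"
  shows "\<bar>y t - p\<bar> \<le> \<bar>y 0 - p\<bar> * exp (- c * t)"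
proof -
  let ?W = "\<lambda>s. ((y s - p) * exp (c * s))\<^sup>2"
  have "?W t \<le> ?W 0"
  proof (rule DERIV_nonpos_imp_decreasing_open[where f = ?W, OF \<open>0 \<le> t\<close>])
    show "continuous_on {0..t} ?W"
      by (intro continuous_intros solves_ode_continuous_on[OF y])
    fix s assume s: "0 < s" "s < t"
    have d: "(?W has_real_derivative
        2 * (exp (c * s))\<^sup>2 * ((y s - p) * f (y s) + c * (y s - p)\<^sup>2)) (at s)"
      using solves_ode_interior[OF y s]
      by (auto intro!: derivative_eq_intros simp: algebra_simps power2_eq_square)
    have "(y s - p) * f (y s) + c * (y s - p)\<^sup>2 \<le> 0"
      using f[OF near[OF s]] by simp
    then have "2 * (exp (c * s))\<^sup>2 * ((y s - p) * f (y s) + c * (y s - p)\<^sup>2) \<le> 0"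
      by (intro mult_nonneg_nonpos) auto
    with d show "\<exists>D. (?W has_real_derivative D) (at s) \<and> D \<le> 0" by blast
  qed
  then have "\<bar>(y t - p) * exp (c * t)\<bar> \<le> \<bar>y 0 - p\<bar>"
    by (simp add: abs_le_square_iff)
  then have "\<bar>y t - p\<bar> * exp (c * t) \<le> \<bar>y 0 - p\<bar>" by (simp add: abs_mult)
  then show ?thesis by (simp add: exp_minus field_simps)
qed

text \<open>Removes the a priori assumption that the solution stays in the ball. Up to a first exit
  time the previous estimate applies, and at that time it still gives at most the initial distance,
  which is less than \<open>r\<close>.\<close>

lemma ode_contraction:
  assumes y: "solves_ode f y {0..T}" and "0 \<le> c"
    and f: "\<And>x. \<bar>x - p\<bar> \<le> r \<Longrightarrow> (x - p) * f x \<le> - c * (x - p)\<^sup>2"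
    and y0: "\<bar>y 0 - p\<bar> < r" and t: "0 \<le> t" "t \<le> T"
  shows "\<bar>y t - p\<bar> \<le> \<bar>y 0 - p\<bar> * exp (- c * t)"
proof -
  have sub: "solves_ode f y {0..s}" if "s \<le> T" for s
    using solves_ode_subset[OF y] that by auto
  have near: "\<bar>y s - p\<bar> < r" if "s \<in> {0..T}" for s
  proof (rule ccontr)
    assume "\<not> \<bar>y s - p\<bar> < r"
    \<comment> \<open>Times at distance at least \<open>r\<close>. The set is compact, so if
      nonempty it has a least element \<open>e\<close>, the first exit time.\<close>
    define E where "E = {s \<in> {0..T}. r \<le> \<bar>y s - p\<bar>}"
    have "closed E"
      unfolding E_def
      by (intro continuous_on_closed_Collect_le continuous_intros solves_ode_continuous_on[OF y])
    moreover have "bounded E" by (rule bounded_subset[of "{0..T}"]) (auto simp: E_def)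
    ultimately have "compact E" by (simp add: compact_eq_bounded_closed)
    moreover have "s \<in> E" using that \<open>\<not> \<bar>y s - p\<bar> < r\<close> by (simp add: E_def)
    ultimately obtain e where e: "e \<in> E" "\<And>u. u \<in> E \<Longrightarrow> e \<le> u"
      using compact_attains_inf[of E] by blast
    have "\<bar>y e - p\<bar> \<le> \<bar>y 0 - p\<bar> * exp (- c * e)"
    proof (rule ode_contraction_on_Icc[OF sub _ \<open>0 \<le> c\<close> f])
      show "\<bar>y u - p\<bar> \<le> r" if "0 < u" "u < e" for u
        using e(2)[of u] e(1) that by (force simp: E_def)
    qed (use e(1) in \<open>auto simp: E_def\<close>)
    also have "\<dots> \<le> \<bar>y 0 - p\<bar>"
      using e(1) \<open>0 \<le> c\<close> by (intro mult_left_le) (auto simp: E_def)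
    finally show False using e(1) y0 by (simp add: E_def)
  qed
  show ?thesis
  proof (rule ode_contraction_on_Icc[OF sub _ \<open>0 \<le> c\<close> f])
    show "\<bar>y s - p\<bar> \<le> r" if "0 < s" "s < t" for s
      using near[of s] that t by simp
  qed (use t in simp_all)
qed

text \<open>The exponential bound never exceeds the initial distance, which gives stability with
  radius \<open>min \<epsilon> r\<close>, and it tends to zero, which gives attraction of every
  global solution starting within \<open>r\<close>.\<close>

lemma ode_asymptotically_stableI:
  assumes "0 < c" "0 < r"
    and f: "\<And>x. \<bar>x - p\<bar> \<le> r \<Longrightarrow> (x - p) * f x \<le> - c * (x - p)\<^sup>2"
  shows "ode_asymptotically_stable f p"
  unfolding ode_asymptotically_stable_def ode_stable_def
proof (intro conjI allI impI)
  fix \<epsilon> :: real assume "\<epsilon> > 0"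
  show "\<exists>\<delta>>0. \<forall>T\<ge>0. \<forall>y. solves_ode f y {0..T} \<and> 0 \<le> y 0 \<and> \<bar>y 0 - p\<bar> < \<delta> \<longrightarrow>
       (\<forall>t\<in>{0..T}. \<bar>y t - p\<bar> < \<epsilon>)"
  proof (intro exI[of _ "min \<epsilon> r"] conjI allI impI ballI)
    fix T t y assume y: "solves_ode f y {0..T} \<and> 0 \<le> y 0 \<and> \<bar>y 0 - p\<bar> < min \<epsilon> r" and t: "t \<in> {0..T}"
    have "\<bar>y t - p\<bar> \<le> \<bar>y 0 - p\<bar> * exp (- c * t)"
      using y t \<open>0 < c\<close> by (intro ode_contraction[OF _ _ f, of y T]) auto
    also have "\<dots> \<le> \<bar>y 0 - p\<bar>"
      using t \<open>0 < c\<close> by (intro mult_left_le) auto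
    finally show "\<bar>y t - p\<bar> < \<epsilon>" using y by simp
  qed (use \<open>\<epsilon> > 0\<close> \<open>0 < r\<close> in auto)
next
  show "\<exists>\<delta>>0. \<forall>y. solves_ode f y {0..} \<and> 0 \<le> y 0 \<and> \<bar>y 0 - p\<bar> < \<delta> \<longrightarrow> (y \<longlongrightarrow> p) at_top"
  proof (intro exI[of _ r] conjI allI impI)
    fix y assume y: "solves_ode f y {0..} \<and> 0 \<le> y 0 \<and> \<bar>y 0 - p\<bar> < r"
    have "\<bar>y t - p\<bar> \<le> \<bar>y 0 - p\<bar> * exp (- c * t)" if "0 \<le> t" for t
      using y that \<open>0 < c\<close>
      by (intro ode_contraction[OF solves_ode_subset _ f, of y "{0..}" t]) auto
    then have "\<forall>\<^sub>F t in at_top. norm (y t - p) \<le> \<bar>y 0 - p\<bar> * exp (- c * t)"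
      by (auto intro: eventually_mono[OF eventually_ge_at_top[of 0]])
    moreover have "((\<lambda>t. \<bar>y 0 - p\<bar> * exp (- c * t)) \<longlongrightarrow> 0) at_top"
    proof (rule tendsto_mult_right_zero, rule filterlim_compose[OF exp_at_bot])
      show "filterlim (\<lambda>t. - c * t) at_bot at_top"
        by (rule filterlim_tendsto_neg_mult_at_bot[OF tendsto_const _ filterlim_ident])
           (use \<open>0 < c\<close> in simp)
    qed
    ultimately have "((\<lambda>t. y t - p) \<longlongrightarrow> 0) at_top"
      by (rule Lim_null_comparison)
    then show "(y \<longlongrightarrow> p) at_top" by (rule LIM_zero_cancel)
  qed (use \<open>0 < r\<close> in auto)
qed

text \<open>
  Existence by separation of variables: the solution is the inverse of \<open>F(x) = \<integral> du / f(u)\<close>.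
  Clamping \<open>f\<close> outside \<open>[a,b]\<close> makes all derivatives two-sided.
\<close>

lemma ode_solution_connecting:
  fixes f :: "real \<Rightarrow> real"
  assumes "a \<le> b" and cont: "continuous_on {a..b} f" and pos: "\<And>x. x \<in> {a..b} \<Longrightarrow> 0 < f x"
  obtains y T where "0 \<le> T" "solves_ode f y {0..T}" "y 0 = a" "y T = b"
proof -
  define g where "g x = f (max a (min b x))" for x
  \<comment> \<open>The margin of 1 on both sides of \<open>[a,b]\<close> puts \<open>a\<close> and
    \<open>b\<close> in the interior of \<open>?S\<close>, so \<open>F\<close> and its inverse have
    two-sided derivatives wherever the solution runs.\<close>
  define F where "F x = integral {a - 1..x} (\<lambda>u. 1 / g u)" for x
  let ?S = "{a - 1..b + 1}"
  have g_pos: "0 < g x" for x using pos \<open>a \<le> b\<close> by (auto simp: g_def)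
  have "continuous_on ?S g"
    unfolding g_def using \<open>a \<le> b\<close>
    by (intro continuous_on_compose2[OF cont] continuous_intros) auto
  then have "continuous_on ?S (\<lambda>u. 1 / g u)"
    using g_pos by (intro continuous_intros) (auto simp: less_imp_neq[THEN not_sym])
  then have F': "(F has_real_derivative 1 / g x) (at x within ?S)" if "x \<in> ?S" for x
    using integral_has_real_derivative[of "a - 1" "b + 1" "\<lambda>u. 1 / g u"] that
    unfolding F_def by blast
  then have contF: "continuous_on ?S F" by (rule DERIV_continuous_on)
  have F_less: "F u < F v" if "u \<in> ?S" "v \<in> ?S" "u < v" for u v
  proof (rule DERIV_pos_imp_increasing_open[OF \<open>u < v\<close>])
    fix x assume "u < x" "x < v"
    then have "(F has_real_derivative 1 / g x) (at x)"
      using F'[of x] that at_within_Icc_at[of "a - 1" x "b + 1"] by force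
    then show "\<exists>D. (F has_real_derivative D) (at x) \<and> 0 < D" using g_pos by force
  next
    show "continuous_on {u..v} F" using that by (intro continuous_on_subset[OF contF]) auto
  qed
  have inj: "inj_on F ?S"
    by (rule linorder_inj_onI') (use F_less in force)
  define z where "z = the_inv_into ?S F"
  have zF: "z (F x) = x" if "x \<in> ?S" for x
    unfolding z_def using inj that by (rule the_inv_into_f_f)
  have image: "{F (a - 1)..F (b + 1)} \<subseteq> F ` ?S"
  proof
    fix v assume "v \<in> {F (a - 1)..F (b + 1)}"
    then obtain x where "a - 1 \<le> x" "x \<le> b + 1" "F x = v"
      using IVT'[of F "a - 1" v "b + 1"] contF \<open>a \<le> b\<close> by auto
    then show "v \<in> F ` ?S" by (intro image_eqI[of _ _ x]) auto
  qed
  have Fz: "F (z s) = s" "z s \<in> ?S" if s: "s \<in> {F (a - 1)..F (b + 1)}" for s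
  proof -
    obtain x where "x \<in> ?S" "s = F x" using image s by blast
    then show "F (z s) = s" "z s \<in> ?S" by (auto simp: zF)
  qed
  have contz: "continuous_on (F ` ?S) z"
    unfolding z_def using contF inj by (intro continuous_on_inv_into) auto
  \<comment> \<open>Shifting time by \<open>F a\<close> makes the solution start at
    \<open>a\<close>; \<open>F b - F a\<close> is the travel time from \<open>a\<close> to
    \<open>b\<close>.\<close>
  let ?T = "F b - F a" and ?y = "\<lambda>t. z (F a + t)"
  have Fab: "F (a - 1) < F a" "F a \<le> F b" "F b < F (b + 1)"
    using F_less[of "a - 1" a] F_less[of a b] F_less[of b "b + 1"] \<open>a \<le> b\<close> by force+
  \<comment> \<open>Such an \<open>s\<close> lies strictly between the end values of
    \<open>F\<close>, so \<open>z s\<close> is an interior point and the inverse function rule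
    applies, with derivative the reciprocal of \<open>1 / g (z s)\<close>.\<close>
  have deriv: "(z has_real_derivative g (z s)) (at s)" if s: "s \<in> {F a..F b}" for s
  proof -
    have s': "F (a - 1) < s" "s < F (b + 1)" using s Fab by auto
    then have "F (z s) = s" "z s \<in> ?S" using Fz[of s] by auto
    moreover from this s' have "z s \<noteq> a - 1" "z s \<noteq> b + 1" by auto
    ultimately have zs: "a - 1 < z s" "z s < b + 1" by auto
    then have "(F has_real_derivative 1 / g (z s)) (at (z s))"
      using F'[of "z s"] at_within_Icc_at[of "a - 1" "z s" "b + 1"] by auto
    moreover have "isCont z s"
      using s' by (intro continuous_on_interior[OF continuous_on_subset[OF contz image]]) auto
    ultimately have "(z has_real_derivative inverse (1 / g (z s))) (at s)"
      using s' Fz g_pos[of "z s"] by (intro DERIV_inverse_function[where f = F and a = "F (a - 1)" and b = "F (b + 1)"]) auto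
    then show ?thesis by simp
  qed
  \<comment> \<open>By monotonicity the solution stays in \<open>[a,b]\<close>, where the clamped
    \<open>g\<close> agrees with \<open>f\<close>.\<close>
  have range: "z s \<in> {a..b}" if s: "s \<in> {F a..F b}" for s
  proof -
    have "F (z s) = s" "z s \<in> ?S" using Fz[of s] s Fab by auto
    then show ?thesis using F_less[of "z s" a] F_less[of b "z s"] s \<open>a \<le> b\<close> by force
  qed
  have "solves_ode f ?y {0..?T}"
    unfolding solves_ode_def
  proof
    fix t assume t: "t \<in> {0..?T}"
    have "(z has_real_derivative g (z (F a + t))) (at (F a + t))" using t by (intro deriv) auto
    then have "(?y has_real_derivative g (?y t) * 1) (at t within {0..?T})"
      by (intro DERIV_chain2[where f = z]) (auto intro!: derivative_eq_intros)
    moreover have "g (?y t) = f (?y t)" using range[of "F a + t"] t by (simp add: g_def)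
    ultimately show "(?y has_real_derivative f (?y t)) (at t within {0..?T})" by simp
  qed
  moreover have "?y 0 = a" "?y ?T = b" using zF \<open>a \<le> b\<close> by auto
  ultimately show ?thesis using that[of ?T ?y] Fab by force
qed

text \<open>From any start slightly to the right of \<open>p\<close> the solution reaches
  \<open>p + r\<close> in finite time, because \<open>f\<close> is continuous and positive on the
  compact interval in between. Starting on the right stays in the half-line even if
  \<open>p = 0\<close>.\<close>

lemma not_ode_stableI:
  fixes f :: "real \<Rightarrow> real"
  assumes "0 \<le> p" "0 < r" and cont: "continuous_on {p..p + r} f"
    and pos: "\<And>x. p < x \<Longrightarrow> x \<le> p + r \<Longrightarrow> 0 < f x"
  shows "\<not> ode_stable f p"
proof
  assume "ode_stable f p"
  from this[unfolded ode_stable_def, THEN spec, THEN mp, OF \<open>0 < r\<close>]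
  obtain \<delta> where "\<delta> > 0" and
    \<delta>: "\<forall>T\<ge>0. \<forall>y. solves_ode f y {0..T} \<and> 0 \<le> y 0 \<and> \<bar>y 0 - p\<bar> < \<delta> \<longrightarrow> (\<forall>t\<in>{0..T}. \<bar>y t - p\<bar> < r)"
    by (elim exE conjE) (rule that)
  define a where "a = p + min \<delta> r / 2"
  have a: "p < a" "a - p < \<delta>" "a \<le> p + r" using \<open>\<delta> > 0\<close> \<open>0 < r\<close> by (auto simp: a_def)
  have "continuous_on {a..p + r} f" using a by (intro continuous_on_subset[OF cont]) auto
  moreover have "\<And>x. x \<in> {a..p + r} \<Longrightarrow> 0 < f x" using pos a by simp
  ultimately obtain y T where "0 \<le> T" "solves_ode f y {0..T}" "y 0 = a" "y T = p + r"
    using ode_solution_connecting[OF a(3)] by blast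
  then have "\<bar>y T - p\<bar> < r"
    using \<delta>[rule_format, of T y T] a \<open>0 \<le> p\<close> by simp
  then show False using \<open>y T = p + r\<close> \<open>0 < r\<close> by simp
qed

text \<open>Suppose \<open>y t\<close> is negative and let \<open>s\<close> be the last earlier time
  with a nonnegative value. After \<open>s\<close> the Lipschitz bound and
  \<open>0 \<le> f 0\<close> give \<open>f (y u) \<ge> L * y u\<close>, so
  \<open>y u * exp (- L * u)\<close> cannot decrease from a nonnegative to a negative value. This
  keeps exact solutions in the region where the scheme's data are constrained.\<close>

lemma ode_solution_nonneg:
  assumes y: "solves_ode f y {0..T}" and "0 \<le> y 0" and "0 \<le> f 0"
    and lip: "\<And>M. \<exists>L. L-lipschitz_on {-M..M} f"
    and t: "t \<in> {0..T}"
  shows "0 \<le> y t"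
proof (rule ccontr)
  assume neg: "\<not> 0 \<le> y t"
  have cont: "continuous_on {0..t} y"
    using t by (intro continuous_on_subset[OF solves_ode_continuous_on[OF y]]) auto
  have "bounded (y ` {0..t})" using cont by (intro compact_imp_bounded compact_continuous_image) auto
  then obtain M where M: "\<And>s. s \<in> {0..t} \<Longrightarrow> \<bar>y s\<bar> \<le> M"
    unfolding bounded_iff real_norm_def by blast
  obtain L where L: "L-lipschitz_on {-M..M} f" using lip by blast
  define E where "E = {s \<in> {0..t}. 0 \<le> y s}"
  have "closed E"
    unfolding E_def by (intro continuous_on_closed_Collect_le continuous_intros cont)
  moreover have "bounded E" by (rule bounded_subset[of "{0..t}"]) (auto simp: E_def)
  ultimately have "compact E" by (simp add: compact_eq_bounded_closed)
  moreover have "0 \<in> E" using t \<open>0 \<le> y 0\<close> by (simp add: E_def)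
  ultimately obtain s where s: "s \<in> E" "\<And>u. u \<in> E \<Longrightarrow> u \<le> s"
    using compact_attains_sup[of E] by blast
  let ?V = "\<lambda>u. y u * exp (- L * u)"
  have "?V s \<le> ?V t"
  proof (rule DERIV_nonneg_imp_increasing_open[where f = ?V])
    show "s \<le> t" using s by (simp add: E_def)
    show "continuous_on {s..t} ?V"
      using s by (intro continuous_intros continuous_on_subset[OF cont]) (auto simp: E_def)
    fix u assume u: "s < u" "u < t"
    have "0 \<le> s" using s by (simp add: E_def)
    have yu: "y u < 0" using s(2)[of u] u \<open>0 \<le> s\<close> by (force simp: E_def)
    have "\<bar>y u\<bar> \<le> M" using M[of u] u \<open>0 \<le> s\<close> by auto
    then have "\<bar>f (y u) - f 0\<bar> \<le> L * \<bar>y u - 0\<bar>"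
      using lipschitz_onD[OF L, of "y u" 0] by (simp add: dist_real_def abs_le_iff)
    \<comment> \<open>Here \<open>\<bar>y u\<bar> = - y u\<close>, so the Lipschitz bound reads
      \<open>f (y u) \<ge> f 0 + L * y u\<close>.\<close>
    then have "0 \<le> exp (- L * u) * (f (y u) - L * y u)"
      using yu \<open>0 \<le> f 0\<close> by (intro mult_nonneg_nonneg) auto
    moreover have "(?V has_real_derivative exp (- L * u) * (f (y u) - L * y u)) (at u)"
      using solves_ode_interior[OF y, of u] u t \<open>0 \<le> s\<close>
      by (auto intro!: derivative_eq_intros simp: algebra_simps)
    ultimately show "\<exists>D. (?V has_real_derivative D) (at u) \<and> 0 \<le> D" by blast
  qed
  moreover have "0 \<le> ?V s" using s by (simp add: E_def)
  moreover have "?V t < 0" using neg by (simp add: mult_neg_pos)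
  ultimately show False by linarith
qed

subsection \<open>Stability of fixed points of one-step recursions\<close>

lemma orbit_nonneg:
  assumes "orbit R y" and "\<And>x x'. 0 \<le> x \<Longrightarrow> R x x' \<Longrightarrow> 0 \<le> x'"
  shows "0 \<le> y n"
proof (induction n)
  case (Suc n)
  then show ?case using assms by (auto simp: orbit_def)
qed (use assms(1) in \<open>simp add: orbit_def\<close>)

text \<open>A local contraction never leaves its ball, so by induction the distance to
  \<open>p\<close> is bounded by a geometric sequence. Preservation of nonnegativity keeps the orbit
  where the contraction estimate is available.\<close>

lemma step_asymptotically_stableI:
  assumes q: "0 \<le> q" "q < 1" and "0 < r"
    and nonneg: "\<And>x x'. 0 \<le> x \<Longrightarrow> R x x' \<Longrightarrow> 0 \<le> x'"
    and contr: "\<And>x x'. 0 \<le> x \<Longrightarrow> \<bar>x - p\<bar> < r \<Longrightarrow> R x x' \<Longrightarrow> \<bar>x' - p\<bar> \<le> q * \<bar>x - p\<bar>"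
  shows "step_asymptotically_stable R p"
proof -
  have bound: "\<bar>y n - p\<bar> \<le> q ^ n * \<bar>y 0 - p\<bar>" if y: "orbit R y" "\<bar>y 0 - p\<bar> < r" for y n
  proof (induction n)
    case (Suc n)
    \<comment> \<open>The geometric bound itself shows that \<open>y n\<close> is still within
      \<open>r\<close>, which licenses the next contraction step.\<close>
    have "q ^ n * \<bar>y 0 - p\<bar> \<le> 1 * \<bar>y 0 - p\<bar>"
      using q by (intro mult_right_mono power_le_one) auto
    then have "\<bar>y n - p\<bar> < r" using Suc y(2) by simp
    then have "\<bar>y (Suc n) - p\<bar> \<le> q * \<bar>y n - p\<bar>"
      using y(1) orbit_nonneg[OF y(1) nonneg] by (intro contr) (auto simp: orbit_def)
    also have "\<dots> \<le> q * (q ^ n * \<bar>y 0 - p\<bar>)" using Suc q by (intro mult_left_mono) auto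
    finally show ?case by simp
  qed simp
  show ?thesis
    unfolding step_asymptotically_stable_def step_stable_def
  proof (intro conjI allI impI)
    fix \<epsilon> :: real assume "\<epsilon> > 0"
    show "\<exists>\<delta>>0. \<forall>y. orbit R y \<and> \<bar>y 0 - p\<bar> < \<delta> \<longrightarrow> (\<forall>n. \<bar>y n - p\<bar> < \<epsilon>)"
    proof (intro exI[of _ "min \<epsilon> r"] conjI allI impI)
      fix y n assume y: "orbit R y \<and> \<bar>y 0 - p\<bar> < min \<epsilon> r"
      then have "\<bar>y n - p\<bar> \<le> q ^ n * \<bar>y 0 - p\<bar>" by (intro bound) auto
      also have "\<dots> \<le> 1 * \<bar>y 0 - p\<bar>"
        using q by (intro mult_right_mono power_le_one) auto
      finally show "\<bar>y n - p\<bar> < \<epsilon>" using y by simp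
    qed (use \<open>\<epsilon> > 0\<close> \<open>0 < r\<close> in auto)
  next
    show "\<exists>\<delta>>0. \<forall>y. orbit R y \<and> \<bar>y 0 - p\<bar> < \<delta> \<longrightarrow> y \<longlonglongrightarrow> p"
    proof (intro exI[of _ r] conjI allI impI)
      fix y assume "orbit R y \<and> \<bar>y 0 - p\<bar> < r"
      then have "\<forall>\<^sub>F n in sequentially. norm (y n - p) \<le> q ^ n * \<bar>y 0 - p\<bar>"
        using bound by (intro always_eventually) simp
      moreover have "(\<lambda>n. q ^ n * \<bar>y 0 - p\<bar>) \<longlonglongrightarrow> 0"
        using q by (intro tendsto_mult_left_zero LIMSEQ_power_zero) auto
      ultimately have "(\<lambda>n. y n - p) \<longlonglongrightarrow> 0"
        by (rule Lim_null_comparison)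
      then show "y \<longlonglongrightarrow> p" by (rule LIM_zero_cancel)
    qed (use \<open>0 < r\<close> in auto)
  qed
qed

text \<open>Stability would confine some orbit starting at distance \<open>\<delta> / 2\<close> to
  the ball of radius \<open>r\<close>, but there each step multiplies the distance by at least
  \<open>q > 1\<close>, so it eventually exceeds \<open>r\<close>.\<close>

lemma not_step_stableI:
  assumes q: "1 < q" and "0 < r" and "0 \<le> p"
    and total: "\<And>x. 0 \<le> x \<Longrightarrow> \<exists>x'. R x x'"
    and nonneg: "\<And>x x'. 0 \<le> x \<Longrightarrow> R x x' \<Longrightarrow> 0 \<le> x'"
    and expand: "\<And>x x'. 0 \<le> x \<Longrightarrow> \<bar>x - p\<bar> < r \<Longrightarrow> R x x' \<Longrightarrow> q * \<bar>x - p\<bar> \<le> \<bar>x' - p\<bar>"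
  shows "\<not> step_stable R p"
proof
  assume "step_stable R p"
  from this[unfolded step_stable_def, THEN spec, THEN mp, OF \<open>0 < r\<close>]
  obtain \<delta> where "\<delta> > 0" and
    "\<forall>y. orbit R y \<and> \<bar>y 0 - p\<bar> < \<delta> \<longrightarrow> (\<forall>n. \<bar>y n - p\<bar> < r)"
    by (elim exE conjE) (rule that)
  then have \<delta>: "\<bar>y n - p\<bar> < r" if "orbit R y" "\<bar>y 0 - p\<bar> < \<delta>" for y n
    using that by simp
  \<comment> \<open>An orbit of the relation is built by dependent choice; the clause for
    \<open>n = 0\<close> pins its start, taken to the right of \<open>p\<close> so that it is
    nonnegative.\<close>
  have "\<exists>y. \<forall>n. (0 \<le> y n \<and> (n = 0 \<longrightarrow> y n = p + \<delta> / 2)) \<and> R (y n) (y (Suc n))"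
  proof (rule dependent_nat_choice)
    show "\<exists>x. 0 \<le> x \<and> (0 = (0::nat) \<longrightarrow> x = p + \<delta> / 2)"
      using \<open>0 \<le> p\<close> \<open>\<delta> > 0\<close> by (intro exI[of _ "p + \<delta> / 2"]) simp
    fix x and n :: nat
    assume "0 \<le> x \<and> (n = 0 \<longrightarrow> x = p + \<delta> / 2)"
    then show "\<exists>x'. (0 \<le> x' \<and> (Suc n = 0 \<longrightarrow> x' = p + \<delta> / 2)) \<and> R x x'"
      using total[of x] nonneg[of x] by blast
  qed
  then obtain y where y': "\<And>n. (0 \<le> y n \<and> (n = 0 \<longrightarrow> y n = p + \<delta> / 2)) \<and> R (y n) (y (Suc n))"
    by blast
  then have y: "orbit R y" "\<And>n. 0 \<le> y n" "y 0 = p + \<delta> / 2"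
    using y'[of 0] \<open>0 \<le> p\<close> \<open>\<delta> > 0\<close> by (simp_all add: orbit_def)
  have near: "\<bar>y n - p\<bar> < r" for n using \<delta>[OF y(1)] y(3) \<open>\<delta> > 0\<close> by auto
  have "q ^ n * (\<delta> / 2) \<le> \<bar>y n - p\<bar>" for n
  proof (induction n)
    case (Suc n)
    have "q * (q ^ n * (\<delta> / 2)) \<le> q * \<bar>y n - p\<bar>" using Suc q by (intro mult_left_mono) auto
    also have "\<dots> \<le> \<bar>y (Suc n) - p\<bar>"
      using y near by (intro expand) (auto simp: orbit_def)
    finally show ?case by simp
  qed (use y(3) \<open>\<delta> > 0\<close> in simp)
  moreover obtain n where "r / (\<delta> / 2) < q ^ n" using real_arch_pow[OF q] by blast
  then have "r < q ^ n * (\<delta> / 2)" using \<open>\<delta> > 0\<close> by (simp add: field_simps)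
  ultimately show False using near[of n] by (meson less_trans not_le)
qed

section \<open>Local estimates from the derivative at a zero or fixed point\<close>

text \<open>At a zero of \<open>f\<close> the difference quotient of the product is
  \<open>k x\<close> times that of \<open>f\<close>, so a limit of \<open>k\<close> suffices in
  place of a derivative.\<close>

lemma has_real_derivative_mult_at_zero:
  fixes f k :: "real \<Rightarrow> real"
  assumes "(f has_real_derivative D) (at p within S)" "f p = 0" "(k \<longlongrightarrow> K) (at p within S)"
  shows "((\<lambda>x. k x * f x) has_real_derivative K * D) (at p within S)"
  using tendsto_mult[OF assms(3) assms(1)[unfolded has_field_derivative_iff]] assms(2)
  by (simp add: has_field_derivative_iff)

text \<open>The absolute difference quotient tends to \<open>\<bar>l\<bar>\<close>, hence lies
  strictly between \<open>a\<close> and \<open>b\<close> near \<open>p\<close>. The upper estimate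
  serves contraction, the lower one expansion; working within \<open>S\<close> covers the boundary
  point of the half-line.\<close>

lemma real_derivative_abs_bounds:
  fixes g :: "real \<Rightarrow> real"
  assumes g: "(g has_real_derivative l) (at p within S)" and l: "a < \<bar>l\<bar>" "\<bar>l\<bar> < b"
  obtains r where "0 < r"
    "\<And>x. x \<in> S \<Longrightarrow> \<bar>x - p\<bar> < r \<Longrightarrow> a * \<bar>x - p\<bar> \<le> \<bar>g x - g p\<bar> \<and> \<bar>g x - g p\<bar> \<le> b * \<bar>x - p\<bar>"
proof -
  have lim: "((\<lambda>x. \<bar>(g x - g p) / (x - p)\<bar>) \<longlongrightarrow> \<bar>l\<bar>) (at p within S)"
    using g unfolding has_field_derivative_iff by (rule tendsto_rabs)
  have "\<forall>\<^sub>F x in at p within S. a < \<bar>(g x - g p) / (x - p)\<bar> \<and> \<bar>(g x - g p) / (x - p)\<bar> < b"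
    using order_tendstoD[OF lim] l by (intro eventually_conj) auto
  then obtain r where r: "0 < r" "\<And>x. x \<in> S \<Longrightarrow> x \<noteq> p \<Longrightarrow> \<bar>x - p\<bar> < r \<Longrightarrow>
      a < \<bar>(g x - g p) / (x - p)\<bar> \<and> \<bar>(g x - g p) / (x - p)\<bar> < b"
    unfolding eventually_at dist_real_def by blast
  show ?thesis
  proof (rule that[OF r(1)])
    fix x assume "x \<in> S" "\<bar>x - p\<bar> < r"
    then show "a * \<bar>x - p\<bar> \<le> \<bar>g x - g p\<bar> \<and> \<bar>g x - g p\<bar> \<le> b * \<bar>x - p\<bar>"
      using r(2)[of x] by (cases "x = p") (auto simp: abs_divide field_simps)
  qed
qed

text \<open>Near \<open>p\<close> the quotient \<open>f x / (x - p)\<close> is below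
  \<open>D / 2\<close>; multiplying by \<open>(x - p)\<^sup>2\<close> gives the dissipativity bound
  with half the linearised rate.\<close>

lemma negative_derivative_imp_dissipative:
  fixes f :: "real \<Rightarrow> real"
  assumes f: "(f has_real_derivative D) (at p)" and "f p = 0" "D < 0"
  obtains r where "0 < r" "\<And>x. \<bar>x - p\<bar> \<le> r \<Longrightarrow> (x - p) * f x \<le> - (- D / 2) * (x - p)\<^sup>2"
proof -
  have "\<forall>\<^sub>F x in at p. (f x - f p) / (x - p) < D / 2"
    using f \<open>D < 0\<close> unfolding has_field_derivative_iff by (intro order_tendstoD) auto
  then obtain r where r: "0 < r" "\<And>x. x \<noteq> p \<Longrightarrow> \<bar>x - p\<bar> < r \<Longrightarrow> f x / (x - p) < D / 2"
    unfolding eventually_at dist_real_def \<open>f p = 0\<close> by auto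
  \<comment> \<open>The estimate holds on an open ball of radius \<open>r\<close>; halving the
    radius gives the closed ball of the conclusion.\<close>
  show ?thesis
  proof (rule that[of "r / 2"])
    fix x assume "\<bar>x - p\<bar> \<le> r / 2"
    then have "f x / (x - p) < D / 2" if "x \<noteq> p" using r that by auto
    then have "(x - p)\<^sup>2 * (f x / (x - p)) \<le> (x - p)\<^sup>2 * (D / 2)" if "x \<noteq> p"
      using that by (intro mult_left_mono) auto
    then show "(x - p) * f x \<le> - (- D / 2) * (x - p)\<^sup>2"
      by (cases "x = p") (auto simp: power2_eq_square mult_ac)
  qed (use r(1) in simp)
qed

subsection \<open>Taylor expansions\<close>

text \<open>An instance of \<open>field_Taylor\<close> with derivatives relative to
  \<open>S\<close>, so that end points of intervals are allowed. Its remainder divides by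
  \<open>fact 2\<close>, which is why the constant is \<open>B / 2\<close>.\<close>

lemma Taylor_quadratic_remainder:
  fixes g g' g'' g''' :: "real \<Rightarrow> real"
  assumes S: "convex S" "w \<in> S" "z \<in> S"
    and deriv: "\<And>x. x \<in> S \<Longrightarrow> (g has_real_derivative g' x) (at x within S)"
      "\<And>x. x \<in> S \<Longrightarrow> (g' has_real_derivative g'' x) (at x within S)"
      "\<And>x. x \<in> S \<Longrightarrow> (g'' has_real_derivative g''' x) (at x within S)"
    and B: "\<And>x. x \<in> S \<Longrightarrow> \<bar>g''' x\<bar> \<le> B"
  shows "\<bar>g z - (g w + g' w * (z - w) + g'' w * (z - w)\<^sup>2 / 2)\<bar> \<le> B / 2 * \<bar>z - w\<bar> ^ 3"
proof -
  define G where "G i = [g, g', g'', g'''] ! i" for i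
  have G: "G 0 = g" "G (Suc 0) = g'" "G (Suc (Suc 0)) = g''" "G (Suc (Suc (Suc 0))) = g'''"
    by (simp_all add: G_def)
  have "(G i has_field_derivative G (Suc i) x) (at x within S)" if "x \<in> S" "i \<le> 2" for i x
  proof -
    consider "i = 0" | "i = 1" | "i = 2" using \<open>i \<le> 2\<close> by linarith
    then show ?thesis using deriv[OF \<open>x \<in> S\<close>] by cases (simp_all add: G eval_nat_numeral)
  qed
  moreover have "norm (G (Suc 2) x) \<le> B" if "x \<in> S" for x
    using B[OF that] by (simp add: G eval_nat_numeral)
  ultimately have "norm (G 0 z - (\<Sum>i\<le>2. G i w * (z - w) ^ i / fact i))
      \<le> B * norm (z - w) ^ Suc 2 / fact 2"
    using S by (intro field_Taylor[of S 2 G B]) auto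
  then show ?thesis by (simp add: G eval_nat_numeral)
qed

text \<open>Differentiating the equation gives \<open>y'' = f'(y) f(y)\<close> and a continuous
  third derivative, bounded on the compact time interval. One constant therefore serves all base
  points \<open>s\<close>, which yields uniformity over the grid.\<close>

lemma ode_solution_Taylor:
  fixes f f' f'' y :: "real \<Rightarrow> real"
  assumes y: "solves_ode f y {0..T}"
    and f: "\<And>x. (f has_real_derivative f' x) (at x)"
    and f': "\<And>x. (f' has_real_derivative f'' x) (at x)"
    and f'': "continuous_on UNIV f''"
  obtains C where "\<And>s t. s \<in> {0..T} \<Longrightarrow> t \<in> {0..T} \<Longrightarrow>
    \<bar>y t - (y s + f (y s) * (t - s) + f' (y s) * f (y s) * (t - s)\<^sup>2 / 2)\<bar> \<le> C * \<bar>t - s\<bar> ^ 3"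
proof -
  \<comment> \<open>The third derivative of the solution, from the product rule applied to
    \<open>f'(y) f(y)\<close>.\<close>
  define y3 where "y3 t = f'' (y t) * f (y t) * f (y t) + f' (y t) * (f' (y t) * f (y t))" for t
  have contf: "continuous_on UNIV f" using DERIV_continuous_on[OF f] by blast
  have contf': "continuous_on UNIV f'" using DERIV_continuous_on[OF f'] by blast
  note conty = solves_ode_continuous_on[OF y]
  have "continuous_on {0..T} y3"
    unfolding y3_def
    by (intro continuous_intros continuous_on_compose2[OF contf conty]
        continuous_on_compose2[OF contf' conty] continuous_on_compose2[OF f'' conty]) auto
  then have "bounded (y3 ` {0..T})"
    by (intro compact_imp_bounded compact_continuous_image) auto
  then obtain B where B: "\<And>t. t \<in> {0..T} \<Longrightarrow> \<bar>y3 t\<bar> \<le> B"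
    unfolding bounded_iff real_norm_def by blast
  have y1: "(y has_real_derivative f (y t)) (at t within {0..T})" if "t \<in> {0..T}" for t
    using y that by (simp add: solves_ode_def)
  have y2: "((\<lambda>t. f (y t)) has_real_derivative f' (y t) * f (y t)) (at t within {0..T})"
    if "t \<in> {0..T}" for t
    by (rule DERIV_chain2[OF f y1[OF that]])
  have "((\<lambda>t. f' (y t)) has_real_derivative f'' (y t) * f (y t)) (at t within {0..T})"
    if "t \<in> {0..T}" for t
    by (rule DERIV_chain2[OF f' y1[OF that]])
  from DERIV_mult'[OF this y2]
  have "((\<lambda>t. f' (y t) * f (y t)) has_real_derivative y3 t) (at t within {0..T})"
    if "t \<in> {0..T}" for t
    using that by (simp add: y3_def algebra_simps)
  from Taylor_quadratic_remainder[OF _ _ _ y1 y2 this B]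
  show ?thesis by (intro that[of "B / 2"]) auto
qed

section \<open>Expansion of the denominator function in the step size\<close>

lemma partial_h_has_derivative:
  assumes "(\<lambda>s. (partial_h ^^ k) \<phi> s y) differentiable (at h within {0..})"
  shows "((\<lambda>s. (partial_h ^^ k) \<phi> s y) has_real_derivative (partial_h ^^ Suc k) \<phi> h y)
    (at h within {0..})"
  using assms
  by (simp add: has_real_derivative_iff_has_vector_derivative vector_derivative_works
      partial_h_def[of "(partial_h ^^ k) \<phi>"])

text \<open>The asymptotic hypothesis concerns only \<open>h > 0\<close>. Differentiability at
  \<open>0\<close> supplies continuity there, which identifies \<open>u 0\<close>; then
  \<open>u h / h\<close> tends both to \<open>1\<close> and to \<open>D\<close>.\<close>

lemma expansion_at_0:
  fixes u :: "real \<Rightarrow> real"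
  assumes u: "(\<lambda>h. u h - h) \<in> O[at_right 0](\<lambda>h. h\<^sup>2)"
    and D: "(u has_real_derivative D) (at 0 within {0..})"
  shows "u 0 = 0" "D = 1"
proof -
  have at: "at 0 within {0..} = at_right (0 :: real)"
    by (simp add: at_within_Ici_at_right)
  obtain c where c: "\<forall>\<^sub>F h in at_right 0. norm (u h - h) \<le> c * norm (h\<^sup>2)"
    using u by (elim landau_o.bigE)
  have "((\<lambda>h. c * norm (h\<^sup>2)) \<longlongrightarrow> 0) (at_right (0::real))"
    by (auto intro!: tendsto_eq_intros)
  then have "((\<lambda>h. u h - h) \<longlongrightarrow> 0) (at_right 0)"
    by (rule Lim_null_comparison[OF c])
  from tendsto_add[OF this tendsto_ident_at]
  have "(u \<longlongrightarrow> 0) (at_right 0)" by simp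
  moreover have "(u \<longlongrightarrow> u 0) (at_right 0)"
    using DERIV_continuous[OF D] by (simp add: continuous_within at)
  ultimately show u0: "u 0 = 0" using tendsto_unique[of "at_right (0::real)" u] by force
  have "\<forall>\<^sub>F h in at_right 0. norm (u h / h - 1) \<le> c * norm h"
    using c eventually_at_right_less[of 0]
  proof eventually_elim
    case (elim h)
    have "u h / h - 1 = (u h - h) / h" using elim(2) by (simp add: diff_divide_distrib)
    then have "norm (u h / h - 1) = norm (u h - h) / h" using elim(2) by (simp add: abs_divide)
    also have "\<dots> \<le> c * norm (h\<^sup>2) / h" using elim by (intro divide_right_mono) auto
    also have "\<dots> = c * norm h" using elim(2) by (simp add: power2_eq_square)
    finally show ?case .
  qed
  moreover have "((\<lambda>h. c * norm h) \<longlongrightarrow> 0) (at_right (0::real))"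
    by (auto intro!: tendsto_eq_intros)
  ultimately have "((\<lambda>h. u h / h - 1) \<longlongrightarrow> 0) (at_right 0)"
    by (rule Lim_null_comparison)
  then have "((\<lambda>h. u h / h) \<longlongrightarrow> 1) (at_right 0)" by (rule LIM_zero_cancel)
  moreover have "((\<lambda>h. u h / h) \<longlongrightarrow> D) (at_right 0)"
    using D u0 by (simp add: has_field_derivative_iff at)
  ultimately show "D = 1" using tendsto_unique[of "at_right (0::real)" "\<lambda>h. u h / h"] by force
qed

text \<open>(H1) fixes the Taylor coefficients of order 0 and 1 as \<open>0\<close> and
  \<open>1\<close>; the jointly continuous third derivative is bounded on a compact rectangle, so
  the cubic remainder is uniform in \<open>y\<close>.\<close>

lemma phi_Taylor:
  assumes C3: "C3_in_h_near_0 \<phi>" and "0 \<le> M"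
    and H1: "\<And>y. y \<ge> 0 \<Longrightarrow> (\<lambda>h. \<phi> h y - h) \<in> O[at_right 0](\<lambda>h. h\<^sup>2)"
  obtains \<delta> C where "0 < \<delta>" "0 \<le> C" "\<And>h y. 0 \<le> h \<Longrightarrow> h < \<delta> \<Longrightarrow> 0 \<le> y \<Longrightarrow> y \<le> M \<Longrightarrow>
    \<bar>\<phi> h y - (h + (partial_h ^^ 2) \<phi> 0 y * h\<^sup>2 / 2)\<bar> \<le> C * h ^ 3"
proof -
  from C3 \<open>0 \<le> M\<close> obtain \<delta> where "\<delta> > 0"
    and diff: "\<forall>k<3. \<forall>h\<in>{0..<\<delta>}. \<forall>y\<in>{0..M}.
         (\<lambda>s. (partial_h ^^ k) \<phi> s y) differentiable (at h within {0..})"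
    and cont: "continuous_on ({0..<\<delta>} \<times> {0..M}) (\<lambda>(h, y). (partial_h ^^ 3) \<phi> h y)"
    unfolding C3_in_h_near_0_def by blast
  \<comment> \<open>Half of \<open>\<delta>\<close> yields a closed interval inside the half-open
    range of step sizes, as compactness requires.\<close>
  let ?S = "{0..\<delta> / 2}"
  have "bounded ((\<lambda>(h, y). (partial_h ^^ 3) \<phi> h y) ` (?S \<times> {0..M}))"
    using \<open>\<delta> > 0\<close>
    by (intro compact_imp_bounded compact_continuous_image continuous_on_subset[OF cont]
        compact_Times) auto
  then obtain B where B: "\<And>h y. h \<in> ?S \<Longrightarrow> y \<in> {0..M} \<Longrightarrow> \<bar>(partial_h ^^ 3) \<phi> h y\<bar> \<le> B"
    unfolding bounded_iff real_norm_def by fastforce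
  have deriv: "((\<lambda>s. (partial_h ^^ k) \<phi> s y) has_real_derivative (partial_h ^^ Suc k) \<phi> h y)
      (at h within {0..})" if "k < 3" "h \<in> ?S" "y \<in> {0..M}" for k h y
    using diff that \<open>\<delta> > 0\<close> by (intro partial_h_has_derivative) auto
  show ?thesis
  proof (rule that[of "\<delta> / 2" "B / 2"])
    show "0 < \<delta> / 2" using \<open>\<delta> > 0\<close> by simp
    have "\<bar>(partial_h ^^ 3) \<phi> 0 0\<bar> \<le> B" using B[of 0 0] \<open>\<delta> > 0\<close> \<open>0 \<le> M\<close> by simp
    then show "0 \<le> B / 2" by linarith
    fix h y assume h: "0 \<le> h" "h < \<delta> / 2" and y: "0 \<le> y" "y \<le> M"
    have "((\<lambda>s. (partial_h ^^ k) \<phi> s y) has_real_derivative (partial_h ^^ Suc k) \<phi> s y)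
      (at s within ?S)" if "k < 3" "s \<in> ?S" for k s
      by (rule has_field_derivative_subset[OF deriv]) (use that y in auto)
    from this[of 0] this[of 1] this[of 2]
    have "\<bar>\<phi> h y - (\<phi> 0 y + (partial_h ^^ 1) \<phi> 0 y * (h - 0)
        + (partial_h ^^ 2) \<phi> 0 y * (h - 0)\<^sup>2 / 2)\<bar> \<le> B / 2 * \<bar>h - 0\<bar> ^ 3"
      using h y B
      by (intro Taylor_quadratic_remainder[where S = ?S and g''' = "\<lambda>s. (partial_h ^^ 3) \<phi> s y"])
         (auto simp: eval_nat_numeral)
    moreover have "((\<lambda>s. \<phi> s y) has_real_derivative (partial_h ^^ 1) \<phi> 0 y) (at 0 within {0..})"
      using deriv[of 0 0 y] y \<open>\<delta> > 0\<close> by simp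
    note expansion_at_0[OF H1[OF y(1)] this]
    ultimately show "\<bar>\<phi> h y - (h + (partial_h ^^ 2) \<phi> 0 y * h\<^sup>2 / 2)\<bar> \<le> B / 2 * h ^ 3"
      using h by simp
  qed
qed

text \<open>Read \<open>P\<close> as \<open>\<phi>\<close>, \<open>b\<close> as
  \<open>\<beta> * fm\<close> and \<open>d\<close> as the derivative of \<open>f\<close>. To second
  order \<open>P / (1 - P * b)\<close> is \<open>P + b * h\<^sup>2\<close>, and this extra term
  cancels the \<open>- b * h\<^sup>2\<close> contained in \<open>P\<close>. The constant depends
  only on the bounds \<open>B\<close>, \<open>K\<close>, \<open>C\<close>, so it is uniform in the
  state.\<close>

lemma denominator_expansion:
  fixes h P b d B C K :: real
  assumes h: "0 < h" "h \<le> 1" and "0 \<le> P" "b \<le> 0" "\<bar>b\<bar> \<le> B" "\<bar>d\<bar> \<le> K" "0 \<le> C"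
    and P: "\<bar>P - (h + (d - 2 * b) * h\<^sup>2 / 2)\<bar> \<le> C * h ^ 3"
  shows "\<bar>P / (1 - P * b) - (h + d * h\<^sup>2 / 2)\<bar>
    \<le> (C + B * ((K + 2 * B) / 2 + C + K / 2 * (1 + (K + 2 * B) / 2 + C))) * h ^ 3"
proof -
  let ?A = "(K + 2 * B) / 2" and ?e = "P - (h + (d - 2 * b) * h\<^sup>2 / 2)"
  \<comment> \<open>The sign conditions keep the denominator at least 1, so dividing by it does not
    enlarge the error.\<close>
  have pos: "1 \<le> 1 - P * b" using assms by (simp add: mult_nonneg_nonpos)
  have "0 \<le> B" "0 \<le> K" using assms by linarith+
  have pow: "h ^ 3 \<le> h" "h\<^sup>2 \<le> h" "h ^ 4 \<le> h ^ 3"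
    using h power_decreasing[of 1 3 h] power_decreasing[of 1 2 h] power_decreasing[of 3 4 h] by auto
  have lin: "\<bar>(d - 2 * b) / 2\<bar> \<le> ?A" using assms by (auto simp: abs_le_iff)
  have quad: "\<bar>(d - 2 * b) / 2 * h\<^sup>2\<bar> \<le> ?A * h\<^sup>2"
    unfolding abs_mult using lin by (intro mult_mono) auto
  \<comment> \<open>A linear bound on \<open>P\<close>: since \<open>h \<le> 1\<close>, the higher
    powers of \<open>h\<close> are absorbed into \<open>h\<close>.\<close>
  have "\<bar>P\<bar> \<le> h + ?A * h\<^sup>2 + C * h ^ 3" using P quad h by (simp only: times_divide_eq_left)
  also have "\<dots> \<le> h + ?A * h + C * h"
    using pow \<open>0 \<le> B\<close> \<open>0 \<le> K\<close> \<open>0 \<le> C\<close> by (intro add_mono mult_left_mono) auto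
  finally have P_le: "\<bar>P\<bar> \<le> (1 + ?A + C) * h" by (simp add: algebra_simps)
  have "\<bar>(d - 2 * b) / 2 * h ^ 3\<bar> \<le> ?A * h ^ 3"
    unfolding abs_mult using lin h by (intro mult_mono) auto
  moreover have "\<bar>h * ?e\<bar> \<le> C * h ^ 3"
  proof -
    have "\<bar>h * ?e\<bar> \<le> h * (C * h ^ 3)"
      unfolding abs_mult using P h by (intro mult_mono) auto
    also have "\<dots> = C * h ^ 4" by (simp add: eval_nat_numeral)
    also have "\<dots> \<le> C * h ^ 3" using pow \<open>0 \<le> C\<close> by (intro mult_left_mono) auto
    finally show ?thesis .
  qed
  moreover have "\<bar>d / 2 * h\<^sup>2 * P\<bar> \<le> K / 2 * (1 + ?A + C) * h ^ 3"
  proof -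
    have "\<bar>d / 2 * h\<^sup>2 * P\<bar> \<le> K / 2 * h\<^sup>2 * ((1 + ?A + C) * h)"
      unfolding abs_mult using P_le \<open>\<bar>d\<bar> \<le> K\<close> by (intro mult_mono) auto
    then show ?thesis by (simp add: eval_nat_numeral mult_ac)
  qed
  \<comment> \<open>Over the denominator \<open>1 - P * b\<close>, the numerator of the difference
    is \<open>?e + b * ?R\<close>: the terms of order two have cancelled, and every summand of
    \<open>?R\<close> is of order three.\<close>
  ultimately have "\<bar>(d - 2 * b) / 2 * h ^ 3 + h * ?e + d / 2 * h\<^sup>2 * P\<bar>
      \<le> (?A + C + K / 2 * (1 + ?A + C)) * h ^ 3" (is "\<bar>?R\<bar> \<le> ?Q")
    by (simp only: distrib_right)
  then have "\<bar>b * ?R\<bar> \<le> B * ?Q"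
    unfolding abs_mult using \<open>\<bar>b\<bar> \<le> B\<close> by (intro mult_mono) auto
  then have num: "\<bar>?e + b * ?R\<bar> \<le> C * h ^ 3 + B * ?Q" using P by linarith
  have eq: "P / (1 - P * b) - (h + d * h\<^sup>2 / 2) = (?e + b * ?R) / (1 - P * b)"
    using pos by (simp add: field_simps eval_nat_numeral)
  have "\<bar>(?e + b * ?R) / (1 - P * b)\<bar> = \<bar>?e + b * ?R\<bar> / (1 - P * b)"
    using pos by (simp add: abs_divide)
  also have "\<dots> \<le> \<bar>?e + b * ?R\<bar> / 1"
    using pos by (intro divide_left_mono) auto
  finally show ?thesis unfolding eq using num by (simp add: algebra_simps)
qed

subsection \<open>The nonstandard scheme\<close>

lemma scheme_map_nonneg:
  assumes "0 \<le> y" "0 \<le> \<phi> h y" "0 \<le> \<beta>" "\<alpha> \<le> 0" "\<alpha> + \<beta> = 1" "fm y \<le> 0" "0 \<le> fp y"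
    and f: "f y = fp y + y * fm y"
  shows "0 \<le> scheme_map f fm \<phi> \<beta> h y"
proof -
  have den: "\<phi> h y * \<beta> * fm y \<le> 0" using assms by (simp add: mult_nonneg_nonpos)
  have \<alpha>: "\<alpha> = 1 - \<beta>" using \<open>\<alpha> + \<beta> = 1\<close> by simp
  \<comment> \<open>This is the numerator of \<open>scheme_map\<close> over its positive
    denominator. Both \<open>\<alpha>\<close> and \<open>fm y\<close> are nonpositive, so their
    product is nonnegative.\<close>
  have "0 \<le> y + \<phi> h y * fp y + \<phi> h y * y * (\<alpha> * fm y)"
    using assms by (intro add_nonneg_nonneg mult_nonneg_nonneg mult_nonpos_nonpos) auto
  also have "\<dots> = y * (1 - \<phi> h y * \<beta> * fm y) + \<phi> h y * f y"
    unfolding \<alpha> f by (simp add: algebra_simps)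
  finally show ?thesis
    using den by (simp add: scheme_map_def add_divide_eq_iff)
qed

text \<open>The map is \<open>x + k x * f x\<close> with \<open>k\<close> continuous on the
  half-line, and \<open>f\<close> vanishes at \<open>p\<close>. The derivative is one-sided at
  \<open>p = 0\<close>, because \<open>\<phi>\<close> and \<open>fm\<close> are constrained only on
  the half-line.\<close>

lemma scheme_map_has_derivative_at_equilibrium:
  assumes "(f has_real_derivative D) (at p)" "f p = 0" "0 \<le> p" "0 \<le> \<beta>"
    and cont: "continuous_on {0..} (\<phi> h)" "continuous_on {0..} fm"
    and sign: "\<And>x. 0 \<le> x \<Longrightarrow> 0 \<le> \<phi> h x" "\<And>x. 0 \<le> x \<Longrightarrow> fm x \<le> 0"
  shows "(scheme_map f fm \<phi> \<beta> h has_real_derivative 1 + \<phi> h p / (1 - \<phi> h p * \<beta> * fm p) * D)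
    (at p within {0..})"
proof -
  define k where "k x = \<phi> h x / (1 - \<phi> h x * \<beta> * fm x)" for x
  have "1 - \<phi> h x * \<beta> * fm x \<noteq> 0" if "0 \<le> x" for x
    using sign[OF that] \<open>0 \<le> \<beta>\<close> mult_nonneg_nonpos[of "\<phi> h x * \<beta>" "fm x"] by simp
  then have "continuous_on {0..} k"
    unfolding k_def by (intro continuous_intros cont) auto
  then have "(k \<longlongrightarrow> k p) (at p within {0..})"
    using \<open>0 \<le> p\<close> by (simp add: continuous_on_def)
  from DERIV_add[OF DERIV_ident has_real_derivative_mult_at_zero[OF
      has_field_derivative_at_within[OF assms(1)] assms(2) this]]
  have "((\<lambda>x. x + k x * f x) has_real_derivative 1 + k p * D) (at p within {0..})" .
  moreover have "(\<lambda>x. x + k x * f x) = scheme_map f fm \<phi> \<beta> h"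
    by (simp add: fun_eq_iff scheme_map_def k_def)
  ultimately show ?thesis by (simp add: k_def)
qed

text \<open>Both the exact solution and one step from the same state \<open>x\<close> agree with
  \<open>x + f x * h + f' x * f x * h\<^sup>2 / 2\<close> up to a cubic error. On
  \<open>{0..T}\<close> the solution stays in some \<open>[0,M]\<close>, so all constants can be
  chosen once.\<close>

lemma scheme_map_local_error:
  fixes f f' f'' fm :: "real \<Rightarrow> real"
  assumes f: "\<And>x. (f has_real_derivative f' x) (at x)"
    and f': "\<And>x. (f' has_real_derivative f'' x) (at x)"
    and f'': "continuous_on UNIV f''"
    and "0 \<le> f 0" "0 \<le> \<beta>"
    and fm: "continuous_on {0..} fm" "\<And>y. 0 \<le> y \<Longrightarrow> fm y \<le> 0"
    and C3: "C3_in_h_near_0 \<phi>"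
    and H1: "\<And>y. y \<ge> 0 \<Longrightarrow> (\<lambda>h. \<phi> h y - h) \<in> O[at_right 0](\<lambda>h. h\<^sup>2)"
    and phi_nonneg: "\<And>h y. h \<ge> 0 \<Longrightarrow> y \<ge> 0 \<Longrightarrow> \<phi> h y \<ge> 0"
    and H3: "\<And>y. y \<ge> 0 \<Longrightarrow> (partial_h ^^ 2) \<phi> 0 y = f' y - 2 * \<beta> * fm y"
  shows "accurate_of_order 2 f (scheme_map f fm \<phi> \<beta>)"
  unfolding accurate_of_order_def
proof (intro allI impI)
  fix T :: real and y assume "0 < T" and y: "solves_ode f y {0..T} \<and> 0 \<le> y 0"
  have contf: "continuous_on A f" for A using DERIV_continuous_on[OF f] continuous_on_subset by blast
  have contf': "continuous_on A f'" for A using DERIV_continuous_on[OF f'] continuous_on_subset by blast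
  have bounded: "\<exists>B\<ge>0. \<forall>x\<in>{a..b}. \<bar>g x\<bar> \<le> B" if "continuous_on {a..b} g" for g :: "real \<Rightarrow> real" and a b
  proof -
    have "bounded (g ` {a..b})" using that by (intro compact_imp_bounded compact_continuous_image) auto
    then obtain B where "\<forall>x\<in>{a..b}. \<bar>g x\<bar> \<le> B" unfolding bounded_iff real_norm_def by blast
    then show ?thesis by (intro exI[of _ "max 0 B"]) auto
  qed
  \<comment> \<open>The mean value bound makes \<open>f\<close> Lipschitz on bounded intervals, as
    the invariance of the half-line requires.\<close>
  have "\<exists>L. L-lipschitz_on {-M..M} f" for M
  proof -
    obtain L where L: "0 \<le> L" "\<forall>x\<in>{-M..M}. \<bar>f' x\<bar> \<le> L" using bounded[OF contf'] by blast
    have "norm (f u - f v) \<le> L * norm (u - v)" if "u \<in> {-M..M}" "v \<in> {-M..M}" for u v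
      by (rule field_differentiable_bound[where S = "{-M..M}" and f' = f'])
         (use L that has_field_derivative_at_within[OF f] in auto)
    then show ?thesis using L(1) by (intro exI[of _ L] lipschitz_onI) (auto simp: dist_norm)
  qed
  then have y_nonneg: "0 \<le> y t" if "t \<in> {0..T}" for t
    using ode_solution_nonneg[OF conjunct1[OF y] conjunct2[OF y] \<open>0 \<le> f 0\<close>] that by blast
  obtain M where M: "0 \<le> M" "\<forall>t\<in>{0..T}. \<bar>y t\<bar> \<le> M"
    using bounded[OF solves_ode_continuous_on[OF conjunct1[OF y]]] by blast
  obtain F where F: "0 \<le> F" "\<forall>x\<in>{0..M}. \<bar>f x\<bar> \<le> F" using bounded[OF contf] by blast
  obtain K where K: "0 \<le> K" "\<forall>x\<in>{0..M}. \<bar>f' x\<bar> \<le> K" using bounded[OF contf'] by blast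
  have "continuous_on {0..M} (\<lambda>x. \<beta> * fm x)"
    by (intro continuous_intros continuous_on_subset[OF fm(1)]) auto
  then obtain B where B: "0 \<le> B" "\<forall>x\<in>{0..M}. \<bar>\<beta> * fm x\<bar> \<le> B" using bounded by blast
  obtain Cy where Cy: "\<And>s t. s \<in> {0..T} \<Longrightarrow> t \<in> {0..T} \<Longrightarrow>
      \<bar>y t - (y s + f (y s) * (t - s) + f' (y s) * f (y s) * (t - s)\<^sup>2 / 2)\<bar> \<le> Cy * \<bar>t - s\<bar> ^ 3"
    using ode_solution_Taylor[OF conjunct1[OF y] f f' f''] by blast
  obtain \<delta> C where "0 < \<delta>" "0 \<le> C" and phi: "\<And>h x. 0 \<le> h \<Longrightarrow> h < \<delta> \<Longrightarrow> 0 \<le> x \<Longrightarrow> x \<le> M \<Longrightarrow>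
      \<bar>\<phi> h x - (h + (partial_h ^^ 2) \<phi> 0 x * h\<^sup>2 / 2)\<bar> \<le> C * h ^ 3"
    using phi_Taylor[OF C3 M(1) H1] by blast
  \<comment> \<open>The constant of \<open>denominator_expansion\<close>. The scheme multiplies that
    error by \<open>f x\<close>, bounded by \<open>F\<close>, whence the final constant
    \<open>Cy + F * Q\<close>; step sizes are kept below 1 for the same expansion.\<close>
  define Q where "Q = C + B * ((K + 2 * B) / 2 + C + K / 2 * (1 + (K + 2 * B) / 2 + C))"
  show "\<exists>C. \<exists>h\<^sub>0>0. \<forall>h\<in>{0<..<h\<^sub>0}. \<forall>n. real (Suc n) * h \<le> T \<longrightarrow>
      \<bar>y (real (Suc n) * h) - scheme_map f fm \<phi> \<beta> h (y (real n * h))\<bar> \<le> C * h ^ (2 + 1)"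
  proof (rule exI[of _ "Cy + F * Q"], rule exI[of _ "min \<delta> 1"], intro conjI ballI allI impI)
    fix h n assume "h \<in> {0<..<min \<delta> 1}" and hT: "real (Suc n) * h \<le> T"
    then have h: "0 < h" "h < \<delta>" "h \<le> 1" by auto
    let ?s = "real n * h" and ?t = "real (Suc n) * h"
    have ts: "?t - ?s = h" by (simp add: algebra_simps)
    have st: "?s \<in> {0..T}" "?t \<in> {0..T}" using hT h by (auto simp: algebra_simps)
    define x where "x = y ?s"
    have x: "0 \<le> x" "x \<le> M" using y_nonneg[OF st(1)] bspec[OF M(2) st(1)] by (simp_all add: x_def)
    let ?k = "\<phi> h x / (1 - \<phi> h x * (\<beta> * fm x))"
    have "\<bar>?k - (h + f' x * h\<^sup>2 / 2)\<bar> \<le> Q * h ^ 3"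
      unfolding Q_def
    proof (rule denominator_expansion)
      show "\<bar>\<phi> h x - (h + (f' x - 2 * (\<beta> * fm x)) * h\<^sup>2 / 2)\<bar> \<le> C * h ^ 3"
        using phi[of h x] H3[of x] h x by (simp add: mult.assoc)
      show "\<beta> * fm x \<le> 0" using fm(2) x \<open>0 \<le> \<beta>\<close> by (intro mult_nonneg_nonpos) auto
      show "0 \<le> \<phi> h x" using phi_nonneg h x by simp
    qed (use h x B K \<open>0 \<le> C\<close> in auto)
    then have k: "\<bar>f x * (?k - (h + f' x * h\<^sup>2 / 2))\<bar> \<le> F * (Q * h ^ 3)"
      unfolding abs_mult using F x by (intro mult_mono) auto
    have "\<bar>y ?t - (x + f x * h + f' x * f x * h\<^sup>2 / 2)\<bar> \<le> Cy * h ^ 3"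
      using Cy[OF st] h(1) unfolding ts x_def by simp
    moreover have "y ?t - scheme_map f fm \<phi> \<beta> h x =
        (y ?t - (x + f x * h + f' x * f x * h\<^sup>2 / 2)) - f x * (?k - (h + f' x * h\<^sup>2 / 2))"
      by (simp add: scheme_map_def algebra_simps)
    ultimately have "\<bar>y ?t - scheme_map f fm \<phi> \<beta> h x\<bar> \<le> Cy * h ^ 3 + F * (Q * h ^ 3)"
      using k by linarith
    also have "\<dots> = (Cy + F * Q) * h ^ (2 + 1)" by (simp add: algebra_simps eval_nat_numeral)
    finally show "\<bar>y ?t - scheme_map f fm \<phi> \<beta> h (y ?s)\<bar> \<le> (Cy + F * Q) * h ^ (2 + 1)"
      unfolding x_def .
  qed (use \<open>0 < \<delta>\<close> in auto)
qed

section \<open>Positivity, elementary stability and second-order accuracy of the scheme\<close>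

theorem theorem2:
  fixes f fp fm :: "real \<Rightarrow> real"
    and \<phi> :: "real \<Rightarrow> real \<Rightarrow> real"
    and \<alpha> \<beta> :: real
  assumes f_C2: "C2_on UNIV f"
    and f_0: "f 0 \<ge> 0"
    and finite_equilibria: "finite (equilibria f)"
    and hyperbolic: "\<And>p. p \<in> equilibria f \<Longrightarrow> deriv f p \<noteq> 0"
    and f_repr: "\<And>y. y \<ge> 0 \<Longrightarrow> f y = fp y + y * fm y"
    and fp_C1: "C1_on {0..} fp"
    and fm_C1: "C1_on {0..} fm"
    and fp_nonneg: "\<And>y. y \<ge> 0 \<Longrightarrow> fp y \<ge> 0"
    and fm_nonpos: "\<And>y. y \<ge> 0 \<Longrightarrow> fm y \<le> 0"
    and scheme_defined: "\<And>h y. h > 0 \<Longrightarrow> y \<ge> 0 \<Longrightarrow> \<phi> h y \<noteq> 0"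
    and phi_continuous: "\<And>h. h > 0 \<Longrightarrow> continuous_on {0..} (\<phi> h)"
    and phi_C3: "C3_in_h_near_0 \<phi>"
    and H1_expansion: "\<And>y. y \<ge> 0 \<Longrightarrow> (\<lambda>h. \<phi> h y - h) \<in> O[at_right 0](\<lambda>h. h ^ 2)"
    and H1_nonneg: "\<And>h y. h \<ge> 0 \<Longrightarrow> y \<ge> 0 \<Longrightarrow> \<phi> h y \<ge> 0"
    and H2: "\<And>h p. h > 0 \<Longrightarrow> p \<in> stable_equilibria f \<Longrightarrow>
               \<phi> h p < 2 / (2 * \<beta> * fm p - deriv f p)"
    and H3: "\<And>y. y \<ge> 0 \<Longrightarrow> (partial_h ^^ 2) \<phi> 0 y = deriv f y - 2 * \<beta> * fm y"
    and H4: "\<alpha> + \<beta> = 1" "\<alpha> \<le> 0" "\<beta> \<ge> 0"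
  shows "positive_scheme (scheme fp fm \<phi> \<alpha> \<beta>) \<and>
         elementary_stable f (scheme fp fm \<phi> \<alpha> \<beta>) \<and>
         accurate_of_order 2 f (scheme_map f fm \<phi> \<beta>)"
proof -
  obtain f' f'' where f': "\<And>x. (f has_real_derivative f' x) (at x)"
    and f'': "\<And>x. (f' has_real_derivative f'' x) (at x)" "continuous_on UNIV f''"
    using f_C2 unfolding C2_on_def C1_on_def by auto
  have deriv_f: "deriv f x = f' x" for x by (rule DERIV_imp_deriv[OF f'])
  have contf: "continuous_on A f" for A
    using DERIV_continuous_on[OF f'] continuous_on_subset by blast
  obtain fm' where "\<And>x. x \<in> {0..} \<Longrightarrow> (fm has_real_derivative fm' x) (at x within {0..})"
    using fm_C1 unfolding C1_on_def by blast
  then have contfm: "continuous_on {0..} fm" by (rule DERIV_continuous_on)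
  have phi_pos: "0 < \<phi> h y" if "0 < h" "0 \<le> y" for h y
    using H1_nonneg[of h y] scheme_defined[of h y] that by force
  let ?S = "scheme fp fm \<phi> \<alpha> \<beta>" and ?G = "scheme_map f fm \<phi> \<beta>"
  have step: "?S h y y' \<longleftrightarrow> y' = ?G h y" if "0 < h" "0 \<le> y" for h y y'
    using that by (intro scheme_iff_scheme_map phi_pos H4 fm_nonpos f_repr)
  have nonneg: "0 \<le> y'" if "0 < h" "0 \<le> y" "?S h y y'" for h y y'
    using that scheme_map_nonneg[of y \<phi> h \<beta> \<alpha> fm fp f] H4
      H1_nonneg[of h y] fm_nonpos[of y] fp_nonneg[of y] f_repr[of y]
    by (simp add: step)
  have den: "1 \<le> 1 - \<phi> h y * \<beta> * fm y" if "0 < h" "0 \<le> y" for h y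
    using phi_pos[OF that] H4(3) fm_nonpos[OF that(2)] mult_nonneg_nonpos[of "\<phi> h y * \<beta>" "fm y"] by simp
  have "positive_scheme ?S"
    unfolding positive_scheme_def using orbit_nonneg nonneg by blast
  moreover have "elementary_stable f ?S"
    unfolding elementary_stable_def
  proof (intro allI impI conjI ballI)
    fix h :: real assume h: "0 < h"
    \<comment> \<open>The increment is a positive multiple of \<open>f\<close>, so it vanishes
      exactly at the equilibria.\<close>
    show "fixed_points (?S h) = equilibria f"
      using den[OF h] phi_pos[OF h]
      by (force simp: fixed_points_def equilibria_def step[OF h] scheme_map_def)
    fix p assume p: "p \<in> equilibria f"
    then have p0: "0 \<le> p" "f p = 0" by (auto simp: equilibria_def)
    define k where "k = \<phi> h p / (1 - \<phi> h p * \<beta> * fm p)"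
    have k_pos: "0 < k" using phi_pos[OF h p0(1)] den[OF h p0(1)] by (simp add: k_def)
    have Gp: "?G h p = p" using p0 by (simp add: scheme_map_def)
    have G': "(?G h has_real_derivative 1 + k * f' p) (at p within {0..})"
      unfolding k_def using h p0 H4 phi_continuous contfm H1_nonneg fm_nonpos
      by (intro scheme_map_has_derivative_at_equilibrium f') auto
    consider "f' p < 0" | "0 < f' p" using hyperbolic[OF p] deriv_f by fastforce
    \<comment> \<open>This dichotomy settles both equivalences: asymptotic stability includes
      stability, so either all four properties hold or all four fail.\<close>
    then have "(ode_asymptotically_stable f p \<and> step_asymptotically_stable (?S h) p) \<or>
        (\<not> ode_stable f p \<and> \<not> step_stable (?S h) p)"
    proof cases
      case 1
      obtain r where "0 < r" "\<And>x. \<bar>x - p\<bar> \<le> r \<Longrightarrow> (x - p) * f x \<le> - (- f' p / 2) * (x - p)\<^sup>2"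
        using negative_derivative_imp_dissipative[OF f' p0(2) 1] by blast
      then have "ode_asymptotically_stable f p"
        using 1 by (intro ode_asymptotically_stableI[of "- f' p / 2" r]) auto
      moreover have "step_asymptotically_stable (?S h) p"
      proof -
        have "\<phi> h p < 2 / (2 * \<beta> * fm p - f' p)"
          using H2[OF h, of p] p 1 by (simp add: stable_equilibria_def deriv_f)
        \<comment> \<open>The positive value \<open>\<phi> h p\<close> lies below the quotient in
          (H2), which forces its denominator to be positive (a zero denominator would make the
          quotient \<open>0\<close>). Only then may the inequality be cleared.\<close>
        moreover from this phi_pos[OF h p0(1)] have "0 < 2 * \<beta> * fm p - f' p"
          by (metis less_trans zero_less_divide_iff zero_less_numeral not_less_iff_gr_or_eq)
        ultimately have "\<phi> h p * (2 * \<beta> * fm p - f' p) < 2" by (simp add: less_divide_eq)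
        then have "\<phi> h p * - f' p < 2 * (1 - \<phi> h p * \<beta> * fm p)" by (simp add: algebra_simps)
        then have "\<phi> h p * - f' p / (1 - \<phi> h p * \<beta> * fm p) < 2"
          using den[OF h p0(1)] by (subst pos_divide_less_eq) simp_all
        then have "k * - f' p < 2" by (simp add: k_def)
        moreover have "k * f' p < 0" using k_pos 1 by (simp add: mult_pos_neg)
        ultimately have l: "\<bar>1 + k * f' p\<bar> < 1" by auto
        \<comment> \<open>The midpoint between the modulus of the multiplier and 1. Only the upper
          estimate is wanted below, so \<open>-1\<close> is a placeholder lower bound.\<close>
        define q where "q = (1 + \<bar>1 + k * f' p\<bar>) / 2"
        have q: "0 \<le> q" "q < 1" "-1 < \<bar>1 + k * f' p\<bar>" "\<bar>1 + k * f' p\<bar> < q"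
          using l by (auto simp: q_def)
        obtain r where r: "0 < r" "\<And>x. x \<in> {0..} \<Longrightarrow> \<bar>x - p\<bar> < r \<Longrightarrow>
            -1 * \<bar>x - p\<bar> \<le> \<bar>?G h x - ?G h p\<bar> \<and> \<bar>?G h x - ?G h p\<bar> \<le> q * \<bar>x - p\<bar>"
          by (rule real_derivative_abs_bounds[OF G' q(3,4)]) (rule that)
        show ?thesis
          using q(1,2) r(1) nonneg[OF h]
        proof (rule step_asymptotically_stableI)
          show "\<bar>x' - p\<bar> \<le> q * \<bar>x - p\<bar>" if "0 \<le> x" "\<bar>x - p\<bar> < r" "?S h x x'" for x x'
            using r(2)[of x] that by (simp add: step[OF h] Gp)
        qed
      qed
      ultimately show ?thesis by blast
    next
      case 2
      obtain d where d: "0 < d" "\<And>x. 0 < x \<Longrightarrow> x < d \<Longrightarrow> 0 < f (p + x)"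
        using DERIV_pos_inc_right[OF f' 2] p0(2) by auto
      have "\<not> ode_stable f p"
      proof (rule not_ode_stableI[OF p0(1) _ contf])
        show "0 < f x" if "p < x" "x \<le> p + d / 2" for x
          using d(2)[of "x - p"] that d(1) by simp
      qed (use d(1) in simp)
      moreover have "\<not> step_stable (?S h) p"
      proof -
        \<comment> \<open>The midpoint between 1 and the multiplier \<open>1 + k * f' p\<close>; the
          upper bound \<open>2 + k * f' p\<close> is merely some number above the
          multiplier.\<close>
        define q where "q = 1 + k * f' p / 2"
        have kf: "0 < k * f' p" using k_pos 2 by simp
        have q: "1 < q" "q < \<bar>1 + k * f' p\<bar>" "\<bar>1 + k * f' p\<bar> < 2 + k * f' p"
          using kf by (auto simp: q_def)
        obtain r where r: "0 < r" "\<And>x. x \<in> {0..} \<Longrightarrow> \<bar>x - p\<bar> < r \<Longrightarrow>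
            q * \<bar>x - p\<bar> \<le> \<bar>?G h x - ?G h p\<bar> \<and> \<bar>?G h x - ?G h p\<bar> \<le> (2 + k * f' p) * \<bar>x - p\<bar>"
          by (rule real_derivative_abs_bounds[OF G' q(2,3)]) (rule that)
        show ?thesis
          using q(1) r(1) p0(1) _ nonneg[OF h]
        proof (rule not_step_stableI)
          show "\<exists>x'. ?S h x x'" if "0 \<le> x" for x using step[OF h that] by blast
          show "q * \<bar>x - p\<bar> \<le> \<bar>x' - p\<bar>" if "0 \<le> x" "\<bar>x - p\<bar> < r" "?S h x x'" for x x'
            using r(2)[of x] that by (simp add: step[OF h] Gp)
        qed
      qed
      ultimately show ?thesis by blast
    qed
    then show "ode_stable f p \<longleftrightarrow> step_stable (?S h) p"
      and "ode_asymptotically_stable f p \<longleftrightarrow> step_asymptotically_stable (?S h) p"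
      by (auto simp: ode_asymptotically_stable_def step_asymptotically_stable_def)
  qed
  moreover have "accurate_of_order 2 f ?G"
    using H3 deriv_f
    by (intro scheme_map_local_error[OF f' f'' f_0 H4(3) contfm fm_nonpos phi_C3 H1_expansion H1_nonneg]) auto
  ultimately show ?thesis by blast
qed

end
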